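(* For every positive integer $n$ there exists a representable comparative probability order $\preceq$ on $[n]=\{1,\dots,n\}$ such that (a) $\preceq$ has exactly $F_{n+1}$ flippable pairs, and (b) all flips of $\preceq$ are friendly, i.e. every comparative probability order obtained from $\preceq$ by flipping over a flippable pair $(A,B)$ with $A\neq\emptyset$ is again representable. Here $F_1=F_2=1$ and $F_{k+2}=F_{k+1}+F_k$ are the Fibonacci numbers.
   Context: A comparative probability order on $X=[n]$ is a linear order $\preceq$ on the power set $2^{X}$ (strict part $\prec$) such that $\emptyset\prec A$ for every nonempty $A\subseteq X$, and $A\preceq B\iff A\cup C\preceq B\cup C$ for all $A,B,C\subseteq X$ with $(A\cup B)\cap C=\emptyset$ (de Finetti's axiom). It is representable if there is a probability measure $(p_1,\dots,p_n)$ on $X$ such that $A\preceq B\iff\sum_{i\in A}p_i\le\sum_{i\in B}p_i$ for all $A,B\subseteq X$ (equivalently, the same with a vector of positive utilities $(u_1,\dots,u_n)$ in place of $p$). Two subsets $A\prec B$ are adjacent if there is no $C\subseteq X$ with $A\prec C\prec B$. A pair $(A,B)$ of disjoint subsets of $X$ is critical for $\preceq$ if $A\prec B$ and $A,B$ are adjacent. A critical pair $(A,B)$ is flippable for $\preceq$ if for every $D\subseteq X$ disjoint from $A\cup B$ the sets $A\cup D$ and $B\cup D$ are adjacent in $\preceq$. (Pairs with $A=\emptyset$ count as flippable pairs if they satisfy this.) If $(A,B)$ is flippable and $A\ne\emptyset$, reversing every comparison $A\cup D\prec B\cup D$, $D\cap(A\cup B)=\emptyset$, to $B\cup D\prec A\cup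 D$ yields another comparative probability order, said to be obtained from $\preceq$ by flipping over $A\prec B$. Two orders related by a flip are friendly if they are both representable or both nonrepresentable. *)

theory Defs
  imports Complex_Main "HOL-Number_Theory.Fib"
begin

(* An order is a relation r :: 'a set rel on Pow X, where (A, B) : r means that A precedes
   or equals B.  Its strict part is r - Id. *)

definition comparative_probability :: "'a set \<Rightarrow> 'a set rel \<Rightarrow> bool" where
  "comparative_probability X r \<longleftrightarrow>
     linear_order_on (Pow X) r \<and>
     (\<forall>A \<subseteq> X. A \<noteq> {} \<longrightarrow> ({}, A) \<in> r - Id) \<and>
     (\<forall>A B C. A \<subseteq> X \<and> B \<subseteq> X \<and> C \<subseteq> X \<and> (A \<union> B) \<inter> C = {} \<longrightarrow>
        ((A, B) \<in> r \<longleftrightarrow> (A \<union> C, B \<union> C) \<in> r))"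

definition representable :: "'a set \<Rightarrow> 'a set rel \<Rightarrow> bool" where
  "representable X r \<longleftrightarrow>
     (\<exists>p :: 'a \<Rightarrow> real. (\<forall>i \<in> X. 0 \<le> p i) \<and> (\<Sum>i \<in> X. p i) = 1 \<and>
        (\<forall>A B. A \<subseteq> X \<and> B \<subseteq> X \<longrightarrow> ((A, B) \<in> r \<longleftrightarrow> (\<Sum>i \<in> A. p i) \<le> (\<Sum>i \<in> B. p i))))"

definition adjacent :: "'a set \<Rightarrow> 'a set rel \<Rightarrow> 'a set \<Rightarrow> 'a set \<Rightarrow> bool" where
  "adjacent X r A B \<longleftrightarrow>
     A \<subseteq> X \<and> B \<subseteq> X \<and> (A, B) \<in> r - Id \<and>
     \<not> (\<exists>C \<subseteq> X. (A, C) \<in> r - Id \<and> (C, B) \<in> r - Id)"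

definition critical_pair :: "'a set \<Rightarrow> 'a set rel \<Rightarrow> 'a set \<Rightarrow> 'a set \<Rightarrow> bool" where
  "critical_pair X r A B \<longleftrightarrow> A \<inter> B = {} \<and> adjacent X r A B"

definition flippable :: "'a set \<Rightarrow> 'a set rel \<Rightarrow> 'a set \<Rightarrow> 'a set \<Rightarrow> bool" where
  "flippable X r A B \<longleftrightarrow>
     critical_pair X r A B \<and>
     (\<forall>D \<subseteq> X. D \<inter> (A \<union> B) = {} \<longrightarrow> adjacent X r (A \<union> D) (B \<union> D))"

definition flip :: "'a set \<Rightarrow> 'a set rel \<Rightarrow> 'a set \<Rightarrow> 'a set \<Rightarrow> 'a set rel" where
  "flip X r A B =
     (r - {(A \<union> D, B \<union> D) | D. D \<subseteq> X \<and> D \<inter> (A \<union> B) = {}})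
       \<union> {(B \<union> D, A \<union> D) | D. D \<subseteq> X \<and> D \<inter> (A \<union> B) = {}}"

definition friendly :: "'a set \<Rightarrow> 'a set rel \<Rightarrow> 'a set rel \<Rightarrow> bool" where
  "friendly X r s \<longleftrightarrow>
     comparative_probability X r \<and> comparative_probability X s \<and>
     (representable X r \<longleftrightarrow> representable X s)"

end

theory Submission
  imports Defs
begin

text \<open>
  Give the atoms the integer utilities \<open>2, 4, \<dots>, 2\<^sup>n\<close> and one odd utility \<open>q\<close>, where \<open>N = n + 1\<close> is the number
  of atoms. All subset sums are distinct, the sums form two arithmetic progressions with step 2
  and opposite parity, and for \<open>q \<le> 2\<^sup>n\<close> a pair of disjoint sets is flippable iff its sums
  differ by exactly 1. Such pairs are the signed binary representations of \<open>q\<close> with \<open>N\<close> digits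
  in \<open>{-1, 0, 1}\<close>; for the Jacobsthal number \<open>q = (2\<^sup>N - (-1)\<^sup>N) / 3\<close> splitting off the leading digit
  gives the Fibonacci recursion.

  If \<open>x = \<chi>\<^sub>B - \<chi>\<^sub>A\<close> has \<open>m\<close> nonzero entries and \<open>u \<bullet> x = 1\<close>, then \<open>v = (2m - 1) u - 2x\<close>
  represents the flipped order: \<open>v \<bullet> x = -1\<close>, and any other \<open>y \<in> {-1, 0, 1}\<^sup>N\<close> with
  \<open>u \<bullet> y > 0\<close> has either \<open>x \<bullet> y \<le> m - 1\<close>, or \<open>x \<bullet> y = m\<close> and \<open>u \<bullet> y \<ge> 2\<close>, so \<open>v \<bullet> y > 0\<close>.
\<close>

section \<open>Orders induced by integer weights with distinct subset sums\<close>

definition weight_order :: "'a set \<Rightarrow> ('a \<Rightarrow> int) \<Rightarrow> 'a set rel" where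
  "weight_order X u = {(P, Q). P \<subseteq> X \<and> Q \<subseteq> X \<and> sum u P \<le> sum u Q}"

lemma weight_order_iff:
  "(P, Q) \<in> weight_order X u \<longleftrightarrow> P \<subseteq> X \<and> Q \<subseteq> X \<and> sum u P \<le> sum u Q"
  by (simp add: weight_order_def)

lemma weight_order_strict_iff:
  assumes "inj_on (sum u) (Pow X)"
  shows "(P, Q) \<in> weight_order X u - Id \<longleftrightarrow> P \<subseteq> X \<and> Q \<subseteq> X \<and> sum u P < sum u Q"
  using inj_onD[OF assms, of P Q] by (auto simp: weight_order_iff less_le)

lemma comparative_probability_weight_order:
  assumes fin: "finite X" and pos: "\<And>i. i \<in> X \<Longrightarrow> 0 < u i" and inj: "inj_on (sum u) (Pow X)"
  shows "comparative_probability X (weight_order X u)"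
  unfolding comparative_probability_def
proof (intro conjI allI impI)
  show "linear_order_on (Pow X) (weight_order X u)"
    unfolding linear_order_on_def partial_order_on_def preorder_on_def
  proof (intro conjI)
    show "antisym (weight_order X u)"
      using inj_onD[OF inj] by (intro antisymI) (simp add: weight_order_iff)
  qed (auto simp: weight_order_iff refl_on_def total_on_def intro: transI)
next
  fix A assume "A \<subseteq> X" "A \<noteq> {}"
  then have "0 < sum u A"
    using fin pos by (intro sum_pos) (auto dest: finite_subset)
  then show "({}, A) \<in> weight_order X u - Id"
    using \<open>A \<subseteq> X\<close> by (auto simp: weight_order_iff)
next
  fix A B C assume "A \<subseteq> X \<and> B \<subseteq> X \<and> C \<subseteq> X \<and> (A \<union> B) \<inter> C = {}"
  moreover from this have "finite A" "finite B" "finite C" "A \<inter> C = {}" "B \<inter> C = {}"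
    using fin by (auto dest: finite_subset)
  ultimately show "((A, B) \<in> weight_order X u) = ((A \<union> C, B \<union> C) \<in> weight_order X u)"
    by (simp add: weight_order_iff sum.union_disjoint)
qed

lemma representable_weight_order:
  assumes fin: "finite X" and "X \<noteq> {}" and pos: "\<And>i. i \<in> X \<Longrightarrow> 0 < u i"
  shows "representable X (weight_order X u)"
proof -
  define s where "s = real_of_int (sum u X)"
  have s: "s > 0"
    using assms by (auto simp: s_def intro!: sum_pos)
  have "(\<Sum>i\<in>A. real_of_int (u i) / s) = real_of_int (sum u A) / s" for A
    by (simp add: sum_divide_distrib)
  moreover have "real_of_int (sum u X) / s = 1"
    using s by (simp add: s_def)
  ultimately show ?thesis
    using s pos unfolding representable_def
    by (intro exI[of _ "\<lambda>i. u i / s"])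
      (auto simp: weight_order_iff divide_le_cancel less_imp_le simp del: of_int_sum)
qed

lemma adjacent_weight_order_iff:
  assumes "inj_on (sum u) (Pow X)"
  shows "adjacent X (weight_order X u) A B \<longleftrightarrow> A \<subseteq> X \<and> B \<subseteq> X \<and> sum u A < sum u B \<and>
    \<not> (\<exists>C \<subseteq> X. sum u A < sum u C \<and> sum u C < sum u B)"
  unfolding adjacent_def weight_order_strict_iff[OF assms] by blast

text \<open>A disjoint \<open>D\<close> shifts both sums equally, so the gap stays 1 and no integer
  fits strictly between.\<close>

lemma flippable_if_sum_differ_by_1:
  assumes fin: "finite X" and inj: "inj_on (sum u) (Pow X)"
    and "A \<subseteq> X" "B \<subseteq> X" "A \<inter> B = {}" and diff: "sum u B = sum u A + 1"
  shows "flippable X (weight_order X u) A B"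
proof -
  have "adjacent X (weight_order X u) (A \<union> D) (B \<union> D)" if D: "D \<subseteq> X" "D \<inter> (A \<union> B) = {}" for D
  proof -
    have "finite A" "finite B" "finite D" "A \<inter> D = {}" "B \<inter> D = {}"
      using D assms by (auto dest: finite_subset)
    then show ?thesis
      using D assms by (auto simp: adjacent_weight_order_iff[OF inj] sum.union_disjoint)
  qed
  from this[of "{}"] this show ?thesis
    using assms by (auto simp: flippable_def critical_pair_def)
qed

subsection \<open>Flips over pairs whose sums differ by one\<close>

locale unit_gap =
  fixes X :: "'a set" and u :: "'a \<Rightarrow> int" and A B :: "'a set"
  assumes fin: "finite X" and pos: "\<And>i. i \<in> X \<Longrightarrow> 0 < u i" and inj: "inj_on (sum u) (Pow X)"
    and AX: "A \<subseteq> X" and BX: "B \<subseteq> X" and disj: "A \<inter> B = {}" and gap: "sum u B = sum u A + 1"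
    and A_nonempty: "A \<noteq> {}"
begin

definition m :: int where "m = card A + card B"

text \<open>With the correction scaled by 2, \<open>2 * m - 1\<close> is the only integer strictly
  between \<open>2 * (m - 1)\<close> and \<open>2 * m\<close>: small enough to reverse the swapped
  pairs, large enough to keep the others.\<close>

definition v :: "'a \<Rightarrow> int" where
  "v i = (2 * m - 1) * u i - 2 * (of_bool (i \<in> B) - of_bool (i \<in> A))"

text \<open>These are exactly the comparisons that the flip reverses.\<close>

definition swapped :: "'a set \<Rightarrow> 'a set \<Rightarrow> bool" where
  "swapped P Q \<longleftrightarrow> (\<exists>D \<subseteq> X. D \<inter> (A \<union> B) = {} \<and> P = A \<union> D \<and> Q = B \<union> D)"

lemma finite_sub: "P \<subseteq> X \<Longrightarrow> finite P"
  using fin finite_subset by blast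

lemma m_ge_2: "m \<ge> 2"
proof -
  have "sum u A \<ge> 0"
    using pos AX by (intro sum_nonneg) force
  then have "B \<noteq> {}"
    using gap by auto
  then have "card A \<noteq> 0" "card B \<noteq> 0"
    using A_nonempty finite_sub AX BX by auto
  then show ?thesis
    by (simp add: m_def)
qed

lemma sum_v:
  assumes "P \<subseteq> X"
  shows "sum v P = (2 * m - 1) * sum u P - 2 * (int (card (P \<inter> B)) - int (card (P \<inter> A)))"
proof -
  have "(\<Sum>i\<in>P. of_bool (i \<in> S) :: int) = card (P \<inter> S)" for S
    using finite_sub[OF assms] by (simp add: of_bool_def sum.If_cases Int_def)
  then show ?thesis
    by (simp add: v_def sum_subtractf sum_distrib_left[symmetric])
qed

lemma sum_swapped:
  assumes "swapped P Q"
  shows "sum u Q = sum u P + 1" "sum v Q = sum v P - 1"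
proof -
  obtain D where D: "D \<subseteq> X" "D \<inter> (A \<union> B) = {}" "P = A \<union> D" "Q = B \<union> D"
    using assms by (auto simp: swapped_def)
  have split: "sum f P = sum f A + sum f D" "sum f Q = sum f B + sum f D" for f :: "'a \<Rightarrow> int"
    using D finite_sub AX BX by (auto intro!: sum.union_disjoint)
  show "sum u Q = sum u P + 1"
    using gap by (simp add: split)
  have "sum v B = sum v A - 1"
    using disj gap sum_v[OF AX] sum_v[OF BX] by (simp add: m_def Int_commute algebra_simps)
  then show "sum v Q = sum v P - 1"
    by (simp add: split)
qed

text \<open>Removing \<open>A\<close> from \<open>P\<close> and \<open>B\<close> from
  \<open>Q\<close> leaves equal sums, hence equal sets by injectivity; this common remainder is the
  witness \<open>D\<close>.\<close>

lemma swapped_if_aligned: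
  assumes PX: "P \<subseteq> X" and QX: "Q \<subseteq> X" and "sum u Q = sum u P + 1"
    and aligned: "B \<subseteq> Q" "Q \<inter> A = {}" "P \<inter> B = {}" "A \<subseteq> P"
  shows "swapped P Q"
proof -
  have "sum u (P - A) = sum u P - sum u A" "sum u (Q - B) = sum u Q - sum u B"
    using aligned finite_sub[OF PX] finite_sub[OF QX] by (simp_all add: sum_diff)
  then have "sum u (P - A) = sum u (Q - B)"
    using assms gap by simp
  then have "P - A = Q - B"
    using PX QX by (intro inj_onD[OF inj]) auto
  then show ?thesis
    unfolding swapped_def using assms disj by (intro exI[of _ "P - A"]) auto
qed

lemma sum_v_less:
  assumes PX: "P \<subseteq> X" and QX: "Q \<subseteq> X" and less: "sum u P < sum u Q" and "\<not> swapped P Q"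
  shows "sum v P < sum v Q"
proof -
  \<comment> \<open>\<open>c\<close> is the inner product of \<open>\<chi>_B - \<chi>_A\<close> with
    \<open>\<chi>_Q - \<chi>_P\<close>. It is at most \<open>m\<close>, with equality only if
    \<open>P\<close> and \<open>Q\<close> are aligned with \<open>A\<close> and
    \<open>B\<close>.\<close>
  define c where "c = int (card (Q \<inter> B)) - card (Q \<inter> A) - card (P \<inter> B) + card (P \<inter> A)"
  have fins: "finite A" "finite B" "finite P" "finite Q"
    using finite_sub AX BX PX QX by auto
  have QB: "card (Q \<inter> B) \<le> card B" and PA: "card (P \<inter> A) \<le> card A"
    using fins by (auto intro: card_mono)
  have eq: "sum v Q - sum v P = (2 * m - 1) * (sum u Q - sum u P) - 2 * c"
    using sum_v[OF PX] sum_v[OF QX] by (simp add: c_def algebra_simps)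
  show ?thesis
  proof (cases "c = m")
    case True
    then have "card (Q \<inter> B) = card B" "card (P \<inter> A) = card A" "card (Q \<inter> A) = 0" "card (P \<inter> B) = 0"
      using QB PA unfolding c_def m_def by linarith+
    then have "Q \<inter> B = B" "P \<inter> A = A" "Q \<inter> A = {}" "P \<inter> B = {}"
      using fins by (auto simp: card_subset_eq)
    \<comment> \<open>A gap of 1 would make the pair swapped, so the gap is at least 2, and
      \<open>2 * (2 * m - 1) > 2 * m\<close> because \<open>m \<ge> 2\<close>.\<close>
    then have "sum u Q \<noteq> sum u P + 1"
      using swapped_if_aligned[OF PX QX] assms by blast
    then have "(2 * m - 1) * 2 \<le> (2 * m - 1) * (sum u Q - sum u P)"
      using less m_ge_2 by (intro mult_left_mono) auto
    then show ?thesis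
      using eq True m_ge_2 by simp
  next
    case False
    then have "c \<le> m - 1"
      using QB PA unfolding c_def m_def by linarith
    moreover have "(2 * m - 1) * 1 \<le> (2 * m - 1) * (sum u Q - sum u P)"
      using less m_ge_2 by (intro mult_left_mono) auto
    ultimately show ?thesis
      using eq by simp
  qed
qed

lemma v_pos: "0 < v i" if "i \<in> X"
proof -
  have "\<not> swapped {} {i}"
    using A_nonempty by (auto simp: swapped_def)
  then show ?thesis
    using sum_v_less[of "{}" "{i}"] pos that by simp
qed

lemma sum_v_less_iff:
  assumes "P \<subseteq> X" "Q \<subseteq> X"
  shows "sum v P < sum v Q \<longleftrightarrow> sum u P < sum u Q \<and> \<not> swapped P Q \<or> swapped Q P"
proof -
  consider "swapped P Q" | "swapped Q P" | "\<not> swapped P Q" "\<not> swapped Q P"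
    by blast
  then show ?thesis
  proof cases
    case 1
    then show ?thesis
      using sum_swapped[of P Q] sum_swapped(1)[of Q P] by linarith
  next
    case 2
    then show ?thesis
      using sum_swapped[of Q P] by simp
  next
    case 3
    have "P = Q" if "sum u P = sum u Q"
      using that assms inj_onD[OF inj] by blast
    then show ?thesis
      using 3 sum_v_less[of P Q] sum_v_less[of Q P] assms
      by (cases "sum u P" "sum u Q" rule: linorder_cases) simp_all
  qed
qed

lemma inj_sum_v: "inj_on (sum v) (Pow X)"
proof (rule inj_onI)
  fix P Q assume PQ: "P \<in> Pow X" "Q \<in> Pow X" and "sum v P = sum v Q"
  then have "sum u P = sum u Q"
    using sum_v_less_iff[of P Q] sum_v_less_iff[of Q P] by auto
  then show "P = Q"
    using PQ by (auto dest: inj_onD[OF inj])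
qed

lemma flip_weight_order: "flip X (weight_order X u) A B = weight_order X v"
proof -
  have "{(A \<union> D, B \<union> D) | D. D \<subseteq> X \<and> D \<inter> (A \<union> B) = {}} = {(P, Q). swapped P Q}"
    "{(B \<union> D, A \<union> D) | D. D \<subseteq> X \<and> D \<inter> (A \<union> B) = {}} = {(P, Q). swapped Q P}"
    unfolding swapped_def by blast+
  then have flip_iff: "(P, Q) \<in> flip X (weight_order X u) A B \<longleftrightarrow>
      (P, Q) \<in> weight_order X u \<and> \<not> swapped P Q \<or> swapped Q P" for P Q
    unfolding flip_def by simp
  have sub: "P \<subseteq> X" "Q \<subseteq> X" if "swapped Q P" for P Q
    using that AX BX unfolding swapped_def by blast+
  have v_iff: "sum v P \<le> sum v Q \<longleftrightarrow> sum u P \<le> sum u Q \<and> \<not> swapped P Q \<or> swapped Q P"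
    if "P \<subseteq> X" "Q \<subseteq> X" for P Q
  proof -
    \<comment> \<open>The non-strict comparison is the negated strict one with \<open>P\<close> and
      \<open>Q\<close> exchanged; this asymmetry brings it into the form of the flip.\<close>
    have "\<not> (swapped P Q \<and> swapped Q P)"
      using sum_swapped(1)[of P Q] sum_swapped(1)[of Q P] by linarith
    then show ?thesis
      using sum_v_less_iff[OF that(2,1)] unfolding not_less[symmetric] by argo
  qed
  show ?thesis
  proof (rule set_eqI)
    fix x :: "'a set \<times> 'a set"
    obtain P Q where x: "x = (P, Q)"
      by fastforce
    show "x \<in> flip X (weight_order X u) A B \<longleftrightarrow> x \<in> weight_order X v"
      unfolding x flip_iff weight_order_iff using sub[of Q P] v_iff[of P Q] by metis
  qed
qed

lemma friendly_flip: "friendly X (weight_order X u) (flip X (weight_order X u) A B)"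
proof -
  have "X \<noteq> {}"
    using A_nonempty AX by auto
  then have "representable X (weight_order X u)" "representable X (weight_order X v)"
    using fin pos v_pos by (simp_all add: representable_weight_order)
  moreover have "comparative_probability X (weight_order X u)"
    using fin pos inj by (rule comparative_probability_weight_order)
  moreover have "comparative_probability X (weight_order X v)"
    using fin v_pos inj_sum_v by (rule comparative_probability_weight_order)
  ultimately show ?thesis
    by (simp add: flip_weight_order friendly_def)
qed

end

subsection \<open>Powers of two and one odd weight\<close>

text \<open>Keeps the simplifier from turning \<open>{1..n}\<close> into
  \<open>{Suc 0..n}\<close>.\<close>

declare One_nat_def [simp del]

text \<open>On \<open>{1..n}\<close> the weights start at 2, so all sums are even and parity reveals
  whether the odd atom is present.\<close>

definition power_weight :: "nat \<Rightarrow> int" where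
  "power_weight i = 2 ^ i"

lemma image_sum_power_weight: "sum power_weight ` Pow {1..n} = (\<lambda>k. 2 * k) ` {0..<2 ^ n}"
proof (induction n)
  case 0
  then show ?case by auto
next
  case (Suc n)
  have "sum power_weight (insert (Suc n) C) = 2 ^ Suc n + sum power_weight C" if "C \<subseteq> {1..n}" for C
    using that by (subst sum.insert) (auto simp: power_weight_def dest: finite_subset)
  then have "sum power_weight ` Pow {1..Suc n} =
      sum power_weight ` Pow {1..n} \<union> (+) (2 ^ Suc n) ` sum power_weight ` Pow {1..n}"
    by (simp add: atLeastAtMostSuc_conv Pow_insert image_Un image_image)
  \<comment> \<open>After halving, the sums without and with the new atom fill two consecutive
    intervals of length \<open>2 ^ n\<close>.\<close>
  also have "\<dots> = (\<lambda>k. 2 * k) ` ({0..<2 ^ n} \<union> (+) (2 ^ n) ` {0..<2 ^ n})"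
    by (simp only: Suc image_Un image_image distrib_left power_Suc)
  also have "{0..<2 ^ n} \<union> (+) (2 ^ n) ` {0..<2 ^ n} = {0..<(2 :: int) ^ Suc n}"
    by (subst image_add_atLeastLessThan) (auto simp: ivl_disj_un)
  finally show ?case .
qed

lemma inj_sum_power_weight: "inj_on (sum power_weight) (Pow {1..n})"
proof (rule eq_card_imp_inj_on)
  show "card (sum power_weight ` Pow {1..n}) = card (Pow {1..n})"
    unfolding image_sum_power_weight by (subst card_image) (auto simp: inj_on_def card_Pow nat_power_eq)
qed simp

lemma sum_power_weight:
  assumes "C \<subseteq> {1..n}"
  shows "0 \<le> sum power_weight C" "sum power_weight C \<le> 2 * 2 ^ n - 2" "even (sum power_weight C)"
proof -
  have "sum power_weight C \<in> (\<lambda>k. 2 * k) ` {0..<2 ^ n}"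
    using assms unfolding image_sum_power_weight[symmetric] by blast
  then show "0 \<le> sum power_weight C" "sum power_weight C \<le> 2 * 2 ^ n - 2" "even (sum power_weight C)"
    by auto
qed

lemma obtain_sum_power_weight:
  assumes "even k" "0 \<le> k" "k \<le> 2 * 2 ^ n - 2"
  obtains C where "C \<subseteq> {1..n}" "sum power_weight C = k"
proof -
  have "k \<in> (\<lambda>k. 2 * k) ` {0..<2 ^ n}"
    using assms by (auto elim!: evenE)
  then show ?thesis
    using that unfolding image_sum_power_weight[symmetric] by auto
qed

locale odd_weight =
  fixes n :: nat and q :: int
  assumes odd_q: "odd q" and q_pos: "0 < q" and q_le: "q \<le> 2 ^ n"
begin

definition u :: "nat \<Rightarrow> int" where
  "u = power_weight(Suc n := q)"

lemma u_pos: "0 < u i"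
  using q_pos by (simp add: u_def power_weight_def)

lemma sum_u:
  assumes "C \<subseteq> {1..Suc n}"
  shows "sum u C = sum power_weight (C - {Suc n}) + (if Suc n \<in> C then q else 0)"
proof -
  have "finite C"
    using assms finite_subset by blast
  moreover have "sum u (C - {Suc n}) = sum power_weight (C - {Suc n})"
    by (rule sum.cong) (auto simp: u_def)
  ultimately show ?thesis
    by (cases "Suc n \<in> C") (auto simp: sum.remove[of C "Suc n"] u_def)
qed

lemma sum_u_cases:
  assumes "C \<subseteq> {1..Suc n}"
  obtains k where "even k" "0 \<le> k" "k \<le> 2 * 2 ^ n - 2" "Suc n \<notin> C" "sum u C = k"
  | k where "even k" "0 \<le> k" "k \<le> 2 * 2 ^ n - 2" "Suc n \<in> C" "sum u C = k + q"
proof -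
  have "C - {Suc n} \<subseteq> {1..n}"
    using assms by auto
  note sum_power_weight[OF this]
  with that[of "sum power_weight (C - {Suc n})"] sum_u[OF assms] show ?thesis
    by (cases "Suc n \<in> C") auto
qed

lemma inj_sum_u: "inj_on (sum u) (Pow {1..Suc n})"
proof (rule inj_onI)
  fix P Q assume "P \<in> Pow {1..Suc n}" "Q \<in> Pow {1..Suc n}" and eq: "sum u P = sum u Q"
  then have P: "P \<subseteq> {1..Suc n}" and Q: "Q \<subseteq> {1..Suc n}"
    by auto
  have iff: "Suc n \<in> P \<longleftrightarrow> Suc n \<in> Q"
    using P eq odd_q by (cases rule: sum_u_cases; use Q in \<open>cases rule: sum_u_cases\<close>) auto
  then have "sum power_weight (P - {Suc n}) = sum power_weight (Q - {Suc n})"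
    using eq sum_u[OF P] sum_u[OF Q] by auto
  moreover have "P - {Suc n} \<in> Pow {1..n}" "Q - {Suc n} \<in> Pow {1..n}"
    using P Q by auto
  ultimately have "P - {Suc n} = Q - {Suc n}"
    by (rule inj_onD[OF inj_sum_power_weight])
  then show "P = Q"
    using iff by auto
qed

lemma ex_even_sum:
  assumes "even k" "0 \<le> k" "k \<le> 2 * 2 ^ n - 2"
  shows "\<exists>C \<subseteq> {1..Suc n}. sum u C = k"
proof -
  obtain C where "C \<subseteq> {1..n}" "sum power_weight C = k"
    using obtain_sum_power_weight assms by blast
  moreover from this have "C \<subseteq> {1..Suc n}" "C - {Suc n} = C" "Suc n \<notin> C"
    by auto
  ultimately show ?thesis
    using sum_u[of C] by (intro exI[of _ C]) auto
qed

lemma ex_odd_sum: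
  assumes "even k" "0 \<le> k" "k \<le> 2 * 2 ^ n - 2"
  shows "\<exists>C \<subseteq> {1..Suc n}. sum u C = k + q"
proof -
  obtain C where "C \<subseteq> {1..n}" "sum power_weight C = k"
    using obtain_sum_power_weight assms by blast
  moreover from this have "insert (Suc n) C \<subseteq> {1..Suc n}" "insert (Suc n) C - {Suc n} = C"
    by auto
  ultimately show ?thesis
    using sum_u[of "insert (Suc n) C"] by (intro exI[of _ "insert (Suc n) C"]) auto
qed

abbreviation ord :: "nat set rel" where
  "ord \<equiv> weight_order {1..Suc n} u"

text \<open>Any other gap leaves room for a subset sum strictly between, either for \<open>A\<close>
  and \<open>B\<close> themselves or after adding the odd atom to both. The cases are which of the
  two sets contains that atom.\<close>

lemma sum_differ_by_1_if_flippable: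
  assumes "flippable {1..Suc n} ord A B"
  shows "sum u B = sum u A + 1"
proof (rule ccontr)
  assume ne: "sum u B \<noteq> sum u A + 1"
  have disj: "A \<inter> B = {}" and "adjacent {1..Suc n} ord A B"
    using assms by (auto simp: flippable_def critical_pair_def)
  then have A: "A \<subseteq> {1..Suc n}" and B: "B \<subseteq> {1..Suc n}" and less: "sum u A < sum u B"
    and between: "\<And>C. C \<subseteq> {1..Suc n} \<Longrightarrow> sum u A < sum u C \<Longrightarrow> sum u C < sum u B \<Longrightarrow> False"
    by (auto simp: adjacent_weight_order_iff[OF inj_sum_u])
  have no_even: False if "even k" "0 \<le> k" "k \<le> 2 * 2 ^ n - 2" "sum u A < k" "k < sum u B" for k
    using ex_even_sum[of k] between that by blast
  have no_odd: False
    if "even k" "0 \<le> k" "k \<le> 2 * 2 ^ n - 2" "sum u A < k + q" "k + q < sum u B" for k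
    using ex_odd_sum[of k] between that by metis
  show False
    using A
  proof (cases rule: sum_u_cases)
    case (1 a)
    note a = this
    show False
      using B
    proof (cases rule: sum_u_cases)
      case (1 b)
      have b: "b = a + 2"
      proof (rule ccontr)
        assume "b \<noteq> a + 2"
        moreover have "a + 2 \<le> b"
          using a(1,5) 1(1,5) less by presburger
        ultimately show False
          using no_even[of "a + 2"] a(1,2,5) 1(3,5) by simp
      qed
      \<comment> \<open>Otherwise \<open>a + 1\<close> is itself a sum using the odd atom, and it
        separates \<open>a\<close> from \<open>a + 2\<close>.\<close>
      have "a + 1 < q"
      proof (rule ccontr)
        assume "\<not> a + 1 < q"
        then show False
          using no_odd[of "a + 1 - q"] a(1,3,5) 1(5) b odd_q q_pos by simp
      qed
      then have "a + 3 \<le> q"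
        using a(1) odd_q by presburger
      then have q: "a + q + 1 \<le> 2 * 2 ^ n - 2"
        using q_le by linarith
      \<comment> \<open>Flippability with \<open>D = {Suc n}\<close> moves the pair to
        \<open>a + q\<close> and \<open>a + q + 2\<close>; the even number between them is small
        enough to be a subset sum.\<close>
      have "adjacent {1..Suc n} ord (A \<union> {Suc n}) (B \<union> {Suc n})"
        using assms[unfolded flippable_def, THEN conjunct2, rule_format, of "{Suc n}"] a(4) 1(4)
        by simp
      moreover have "finite A" "finite B"
        using A B finite_subset by blast+
      then have "sum u (A \<union> {Suc n}) = a + q" "sum u (B \<union> {Suc n}) = b + q"
        using a(4,5) 1(4,5) by (simp_all add: u_def)
      moreover obtain C where "C \<subseteq> {1..Suc n}" "sum u C = a + q + 1"
        using ex_even_sum[of "a + q + 1"] a(1,2) q odd_q q_pos by auto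
      moreover from calculation have "sum u (A \<union> {Suc n}) < sum u C"
        "sum u C < sum u (B \<union> {Suc n})"
        using b by linarith+
      ultimately show False
        unfolding adjacent_weight_order_iff[OF inj_sum_u] by blast
    next
      case (2 b)
      \<comment> \<open>Disjointness bounds \<open>a + b\<close>. If \<open>a\<close> were the
        largest even sum, \<open>b\<close> would be 0 and \<open>q \<le> 2 ^ n\<close> would be too
        small for the gap; hence \<open>a + 2\<close> is a subset sum, lying strictly
        between.\<close>
      have "A \<union> (B - {Suc n}) \<subseteq> {1..n}"
        using A B a(4) by (auto simp: le_Suc_eq)
      then have "sum power_weight (A \<union> (B - {Suc n})) \<le> 2 * 2 ^ n - 2"
        by (rule sum_power_weight)
      also have "sum power_weight (A \<union> (B - {Suc n})) =
          sum power_weight A + sum power_weight (B - {Suc n})"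
        using A B disj by (intro sum.union_disjoint) (auto dest: finite_subset)
      also have "\<dots> = a + b"
        using sum_u[OF A] sum_u[OF B] a(4,5) 2(4,5) by simp
      finally have ab: "a + b \<le> 2 * 2 ^ n - 2" .
      have "a + 3 \<le> b + q"
        using a(1,5) 2(1,5) less ne odd_q by presburger
      with ab have "a + 2 \<le> 2 * 2 ^ n - 2"
        using a(1,2) 2(1,2) q_le by presburger
      then show False
        using no_even[of "a + 2"] a(1,2,5) 2(5) \<open>a + 3 \<le> b + q\<close> by simp
    qed
  next
    case (2 a)
    note a = this
    show False
      using B
    proof (cases rule: sum_u_cases)
      case (1 b)
      have "a + q + 3 \<le> b"
        using a(1,5) 1(1,5) less ne odd_q by presburger
      then show False
        using no_even[of "b - 2"] a(2,5) 1(1,3,5) q_pos by simp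
    next
      case (2 b)
      then show False
        using a(4) disj by blast
    qed
  qed
qed

lemma flippable_iff:
  "flippable {1..Suc n} ord A B \<longleftrightarrow>
    A \<subseteq> {1..Suc n} \<and> B \<subseteq> {1..Suc n} \<and> A \<inter> B = {} \<and> sum u B = sum u A + 1"
proof
  assume flippable: "flippable {1..Suc n} ord A B"
  then have "A \<subseteq> {1..Suc n} \<and> B \<subseteq> {1..Suc n} \<and> A \<inter> B = {}"
    unfolding flippable_def critical_pair_def adjacent_def by simp
  then show "A \<subseteq> {1..Suc n} \<and> B \<subseteq> {1..Suc n} \<and> A \<inter> B = {} \<and> sum u B = sum u A + 1"
    using sum_differ_by_1_if_flippable[OF flippable] by simp
next
  assume "A \<subseteq> {1..Suc n} \<and> B \<subseteq> {1..Suc n} \<and> A \<inter> B = {} \<and> sum u B = sum u A + 1"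
  then show "flippable {1..Suc n} ord A B"
    by (intro flippable_if_sum_differ_by_1 inj_sum_u) simp_all
qed

end

subsection \<open>Counting signed representations\<close>

text \<open>A pair \<open>(A, B)\<close> encodes the signed representation of \<open>k\<close> with digits 1 on \<open>B\<close> and -1 on \<open>A\<close>.\<close>

definition signed_reps :: "(nat \<Rightarrow> int) \<Rightarrow> nat \<Rightarrow> int \<Rightarrow> (nat set \<times> nat set) set" where
  "signed_reps w n k =
    {(A, B). A \<subseteq> {1..n} \<and> B \<subseteq> {1..n} \<and> A \<inter> B = {} \<and> sum w B = sum w A + k}"

lemma finite_signed_reps [simp]: "finite (signed_reps w n k)"
  by (rule finite_subset[of _ "Pow {1..n} \<times> Pow {1..n}"]) (simp_all add: signed_reps_def split_def subset_iff)

lemma signed_reps_0: "signed_reps w 0 k = (if k = 0 then {({}, {})} else {})"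
  by (auto simp: signed_reps_def)

text \<open>Exchanging \<open>A\<close> and \<open>B\<close> negates every digit.\<close>

lemma card_signed_reps_minus: "card (signed_reps w n (- k)) = card (signed_reps w n k)"
proof -
  have "signed_reps w n (- k) = prod.swap ` signed_reps w n k"
    by (force simp: signed_reps_def)
  then show ?thesis
    by (simp add: card_image)
qed

lemma signed_reps_cong:
  assumes "\<And>i. i \<in> {1..n} \<Longrightarrow> w i = w' i"
  shows "signed_reps w n k = signed_reps w' n k"
proof -
  have "sum w A = sum w' A" if "A \<subseteq> {1..n}" for A
    using assms that by (intro sum.cong) auto
  then show ?thesis
    by (auto simp: signed_reps_def)
qed

text \<open>The three summands correspond to the digits 0, 1 and -1 at position
  \<open>Suc n\<close>; \<open>f\<close> and \<open>g\<close> insert the digits 1 and -1.\<close>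

lemma card_signed_reps_Suc:
  "card (signed_reps w (Suc n) k) = card (signed_reps w n k)
    + card (signed_reps w n (k - w (Suc n))) + card (signed_reps w n (k + w (Suc n)))"
proof -
  define f where "f = (apsnd (insert (Suc n)) :: nat set \<times> nat set \<Rightarrow> _)"
  define g where "g = (apfst (insert (Suc n)) :: nat set \<times> nat set \<Rightarrow> _)"
  let ?Z = "signed_reps w n k" and ?P = "signed_reps w n (k - w (Suc n))"
    and ?M = "signed_reps w n (k + w (Suc n))"
  have sub: "C \<subseteq> {1..Suc n} \<longleftrightarrow> (if Suc n \<in> C then C - {Suc n} \<subseteq> {1..n} else C \<subseteq> {1..n})" for C
  proof -
    have "{1..Suc n} = insert (Suc n) {1..n}"
      by auto
    then show ?thesis
      by auto
  qed
  have ins: "sum w (insert (Suc n) C) = w (Suc n) + sum w C" if "C \<subseteq> {1..n}" for C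
    using that by (subst sum.insert) (auto dest: finite_subset)
  have rem: "sum w C = w (Suc n) + sum w (C - {Suc n})" if "Suc n \<in> C" "C - {Suc n} \<subseteq> {1..n}" for C
    using ins[OF that(2)] that(1) by (simp add: insert_absorb)
  have cover: "x \<in> ?Z \<union> f ` ?P \<union> g ` ?M" if x: "x \<in> signed_reps w (Suc n) k" for x
  proof -
    obtain A B where AB: "x = (A, B)" by fastforce
    have x: "A \<subseteq> {1..Suc n}" "B \<subseteq> {1..Suc n}" "A \<inter> B = {}" "sum w B = sum w A + k"
      using x by (simp_all add: AB signed_reps_def)
    consider "Suc n \<in> B" "Suc n \<notin> A" | "Suc n \<in> A" "Suc n \<notin> B" | "Suc n \<notin> A" "Suc n \<notin> B"
      using x(3) by blast
    then show ?thesis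
    proof cases
      case 1
      then have sub': "A \<subseteq> {1..n}" "B - {Suc n} \<subseteq> {1..n}"
        using x(1,2) sub by metis+
      have "(A, B - {Suc n}) \<in> ?P"
        using sub' x(3,4) rem[OF 1(1) sub'(2)] by (auto simp: signed_reps_def)
      moreover have "x = f (A, B - {Suc n})"
        using 1 by (auto simp: AB f_def)
      ultimately show ?thesis by blast
    next
      case 2
      then have sub': "A - {Suc n} \<subseteq> {1..n}" "B \<subseteq> {1..n}"
        using x(1,2) sub by metis+
      have "(A - {Suc n}, B) \<in> ?M"
        using sub' x(3,4) rem[OF 2(1) sub'(1)] by (auto simp: signed_reps_def)
      moreover have "x = g (A - {Suc n}, B)"
        using 2 by (auto simp: AB g_def)
      ultimately show ?thesis by blast
    next
      case 3
      then have "A \<subseteq> {1..n}" "B \<subseteq> {1..n}"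
        using x(1,2) sub by metis+
      then show ?thesis
        using x(3,4) by (simp add: signed_reps_def AB)
    qed
  qed
  have fresh: "C \<subseteq> {1..Suc n}" "Suc n \<notin> C" if "C \<subseteq> {1..n}" for C
    using that by auto
  have "?Z \<subseteq> signed_reps w (Suc n) k"
    by (auto simp: signed_reps_def)
  moreover have "f ` ?P \<subseteq> signed_reps w (Suc n) k" "g ` ?M \<subseteq> signed_reps w (Suc n) k"
    by (clarsimp simp: signed_reps_def f_def g_def ins fresh)+
  ultimately have union: "signed_reps w (Suc n) k = ?Z \<union> f ` ?P \<union> g ` ?M"
    using cover by blast
  have new: "Suc n \<notin> fst x" "Suc n \<notin> snd x" if "x \<in> signed_reps w n l" for x l
    using that by (auto simp: signed_reps_def)
  have f: "fst (f x) = fst x" "snd (f x) = insert (Suc n) (snd x)"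
    and g: "fst (g x) = insert (Suc n) (fst x)" "snd (g x) = snd x" for x
    by (simp_all add: f_def g_def)
  have "inj_on f ?P" "inj_on g ?M"
    by (intro inj_onI prod_eqI; metis f g new insert_ident)+
  moreover have fP: "Suc n \<in> snd x" "Suc n \<notin> fst x" if "x \<in> f ` ?P" for x
    using that new by (elim imageE; simp add: f)+
  have gM: "Suc n \<in> fst x" if "x \<in> g ` ?M" for x
    using that by (elim imageE) (simp add: g)
  have "?Z \<inter> f ` ?P = {}"
    using fP(1) new(2) by blast
  moreover have "(?Z \<union> f ` ?P) \<inter> g ` ?M = {}"
    using fP(2) gM new(1) by blast
  moreover note union
  ultimately show ?thesis
    by (simp add: card_Un_disjoint card_image)
qed

text \<open>
  For odd \<open>q\<close> this is the number of signed binary representations of \<open>q\<close> with \<open>n + 1\<close> digits: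
  the lowest digit must be 1 or -1, the others have the weights \<open>2, 4, \<dots>, 2\<^sup>n\<close>.
\<close>

definition odd_reps :: "nat \<Rightarrow> int \<Rightarrow> nat" where
  "odd_reps n q = card (signed_reps power_weight n (q - 1)) + card (signed_reps power_weight n (q + 1))"

lemma odd_reps_Suc:
  "odd_reps (Suc n) q = odd_reps n q + odd_reps n (q - 2 ^ Suc n) + odd_reps n (q + 2 ^ Suc n)"
  by (simp add: odd_reps_def card_signed_reps_Suc power_weight_def algebra_simps)

lemma odd_reps_minus: "odd_reps n (- q) = odd_reps n q"
  using card_signed_reps_minus[of power_weight n "q - 1"]
    card_signed_reps_minus[of power_weight n "q + 1"]
  by (simp add: odd_reps_def)

text \<open>The largest value with \<open>n + 1\<close> digits is
  \<open>2 * 2 ^ n - 1\<close>.\<close>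

lemma odd_reps_eq_0: "odd_reps n q = 0" if "q \<ge> 2 * 2 ^ n"
proof -
  have "signed_reps power_weight n k = {}" if "k > 2 * 2 ^ n - 2" for k
  proof -
    have "sum power_weight B \<noteq> sum power_weight A + k" if "A \<subseteq> {1..n}" "B \<subseteq> {1..n}" for A B
      using sum_power_weight(1)[OF that(1)] sum_power_weight(2)[OF that(2)] \<open>k > _\<close> by linarith
    then show ?thesis
      by (auto simp: signed_reps_def)
  qed
  then show ?thesis
    using that by (simp add: odd_reps_def)
qed

text \<open>The sequence 1, 1, 3, 5, 11, ..., that is \<open>(2 ^ (n + 1) + (-1) ^ n) / 3\<close>.
  In this form of the recursion, subtracting the leading power leaves the negated
  predecessor.\<close>

fun jacobsthal :: "nat \<Rightarrow> int" where
  "jacobsthal 0 = 1"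
| "jacobsthal (Suc n) = 2 ^ Suc n - jacobsthal n"

lemma jacobsthal_bounds: "0 < jacobsthal n" "jacobsthal n \<le> 2 ^ n"
  by (induction n) auto

lemma odd_jacobsthal: "odd (jacobsthal n)"
  by (induction n) auto

lemma odd_reps_jacobsthal: "odd_reps n (jacobsthal n) = fib (n + 2)"
proof (induction n rule: fib.induct)
  case 1
  then show ?case
    by (simp add: odd_reps_def signed_reps_0)
next
  case 2
  then show ?case
    by (simp add: odd_reps_Suc) (simp add: odd_reps_def signed_reps_0)
next
  case (3 n)
  let ?q = "jacobsthal (Suc (Suc n))"
  have q: "?q = 2 ^ Suc n + jacobsthal n"
    by simp
  \<comment> \<open>Leading digit 1 leaves \<open>- jacobsthal (Suc n)\<close>, counted up to sign
    by the induction hypothesis.\<close>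
  have "odd_reps (Suc n) (?q - 2 ^ Suc (Suc n)) = fib (n + 3)"
    using 3(1) odd_reps_minus[of "Suc n" "jacobsthal (Suc n)"] by (simp add: numeral_3_eq_3)
  moreover have "odd_reps (Suc n) (?q + 2 ^ Suc (Suc n)) = 0"
    using jacobsthal_bounds(1)[of "Suc (Suc n)"] by (intro odd_reps_eq_0) simp
  \<comment> \<open>Leading digit 0: by \<open>q\<close> the next digit must be 1, since 0 or -1
    leaves too large a remainder. What remains is \<open>jacobsthal n\<close>.\<close>
  moreover have "odd_reps (Suc n) ?q = fib (n + 2)"
    using 3(2) jacobsthal_bounds(1)[of n]
    unfolding q odd_reps_Suc by (simp add: odd_reps_eq_0)
  ultimately show ?case
    unfolding odd_reps_Suc[of "Suc n"] by (simp add: numeral_3_eq_3)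
qed

section \<open>Number of flippable pairs and choice of the odd weight\<close>

context odd_weight
begin

text \<open>Flippable pairs represent 1 with the weights \<open>2, ..., 2 ^ n, q\<close>. Moving
  \<open>q\<close> to the other side exchanges the roles of 1 and \<open>q\<close>, which gives the
  signed binary representations of \<open>q\<close> up to sign.\<close>

lemma card_flippable: "card {(A, B). flippable {1..Suc n} ord A B} = odd_reps n q"
proof -
  have "{(A, B). flippable {1..Suc n} ord A B} = signed_reps u (Suc n) 1"
    by (auto simp: flippable_iff signed_reps_def)
  moreover have "signed_reps u n k = signed_reps power_weight n k" for k
    by (rule signed_reps_cong) (auto simp: u_def)
  \<comment> \<open>The odd atom must occur, since a difference of even sums is never 1.\<close>
  moreover have "signed_reps power_weight n 1 = {}"
  proof -
    have "sum power_weight B \<noteq> sum power_weight A + 1" if "A \<subseteq> {1..n}" "B \<subseteq> {1..n}" for A B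
      using sum_power_weight(3)[OF that(1)] sum_power_weight(3)[OF that(2)] by presburger
    then show ?thesis
      by (auto simp: signed_reps_def)
  qed
  moreover have "u (Suc n) = q"
    by (simp add: u_def)
  ultimately show ?thesis
    using card_signed_reps_minus[of power_weight n "q - 1"]
    by (simp add: card_signed_reps_Suc odd_reps_def add.commute)
qed

end

theorem theorem3:
  fixes n :: nat
  assumes "n \<ge> 1"
  shows "\<exists>r :: nat set rel.
    comparative_probability {1..n} r \<and> representable {1..n} r \<and>
    card {(A, B). flippable {1..n} r A B} = fib (n + 1) \<and>
    (\<forall>A B. flippable {1..n} r A B \<and> A \<noteq> {} \<longrightarrow> friendly {1..n} r (flip {1..n} r A B))"
proof -
  \<comment> \<open>One of the \<open>n\<close> atoms carries the odd weight, leaving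
    \<open>k = n - 1\<close> powers of two; thus \<open>fib (k + 2)\<close> is
    \<open>fib (n + 1)\<close>.\<close>
  obtain k where n: "n = Suc k"
    using assms by (cases n) auto
  interpret odd_weight k "jacobsthal k"
    by unfold_locales (simp_all only: odd_jacobsthal jacobsthal_bounds not_False_eq_True)
  have "friendly {1..n} ord (flip {1..n} ord A B)" if "flippable {1..n} ord A B" "A \<noteq> {}" for A B
  proof -
    have "unit_gap {1..n} u A B"
      using that(2) that(1)[unfolded n flippable_iff] inj_sum_u u_pos
      unfolding n by (intro unit_gap.intro) simp_all
    then show ?thesis
      unfolding n by (rule unit_gap.friendly_flip)
  qed
  moreover have "comparative_probability {1..n} ord"
    unfolding n by (intro comparative_probability_weight_order inj_sum_u u_pos finite_atLeastAtMost)
  moreover have "representable {1..n} ord"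
    unfolding n by (rule representable_weight_order) (simp_all add: u_pos)
  moreover have "card {(A, B). flippable {1..n} ord A B} = fib (n + 1)"
    unfolding n card_flippable odd_reps_jacobsthal by (simp add: One_nat_def)
  ultimately show ?thesis
    by blast
qed

end
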